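(* Consider the networked electricity market described in the context, under its standing assumptions, and for each $n\in\mathcal{N}_g$ let a partition $\mathcal{P}(n)$ of the neighbors of $n$ and a cycle mapping $\mathcal{C}_n$ be chosen arbitrarily, with resulting effective flow limits $\hat{f}_{nm}$. Then the price of anarchy satisfies $$\mathrm{PoA}=\frac{\sum_{n\in\mathcal{N}_g}c_n(s_n^{**})}{\sum_{n\in\mathcal{N}_g}c_n(s_n^{*})}\ \le\ 1+\max_{n\in\mathcal{N}_g}\frac{\min\left\{\bar{s}_n,\ D-\sum_{m\in\mathcal{N}_g,\,m\neq n}\underline{s}_m,\ d_n+\sum_{m\in\mathcal{N}(n)}\hat{f}_{nm}\right\}}{(|\mathcal{N}_g|-2)D}.$$
   Context: Network. $(\mathcal{N},\mathcal{E})$ is a finite connected simple graph (nodes are buses, edges are transmission lines); $\mathcal{N}(n)$ is the set of neighbors of node $n$. $\mathcal{N}_g\subseteq\mathcal{N}$ is the set of buses having a generator (each owned by a different supplier), with $|\mathcal{N}_g|>2$. Bus $j$ has an inelastic load $d_j\ge 0$; $\bm{d}=(d_j)_{j\in\mathcal{N}}$ and $D=\sum_{j\in\mathcal{N}}d_j>0$. Line $\{i,j\}$ has admittance $B_{ij}=B_{ji}>0$ and flow limit $f_{ij}=f_{ji}\ge 0$; $\bm{f}$ is the vector of flow limits. Line flows (linearized power flow model). Fix an orientation of each edge. If $\sum_{n\in\mathcal{N}_g}s_n=D$, the line flows $(p_{ij})$, with $p_{ij}=-p_{ji}$ the flow from $i$ to $j$, are the unique ones for which there are voltage angles $(\theta_i)$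 with $p_{ij}=B_{ij}(\theta_i-\theta_j)$ on each edge, and for which, at each bus $m$, $\sum_{i\in\mathcal{N}(m)}p_{mi}$ equals the net injection ($s_m-d_m$ if $m\in\mathcal{N}_g$, $-d_m$ otherwise). The shift-factor matrices $\mathbf{A}_g\in\mathbb{R}^{|\mathcal{E}|\times|\mathcal{N}_g|}$ and $\mathbf{A}_\ell\in\mathbb{R}^{|\mathcal{E}|\times|\mathcal{N}|}$ are matrices such that the vector of line flows is $\mathbf{A}_g\bm{s}+\mathbf{A}_\ell\bm{d}$. $[\mathbf{A}]_{*n}$ denotes the $n$th column of a matrix $\mathbf{A}$. Standing assumptions. (1) For each $n\in\mathcal{N}_g$, the cost function $c_n:[0,\infty)\to[0,\infty)$ is convex, strictly increasing and differentiable. (2) Supplies satisfy $\underline{s}_n\le s_n\le\bar{s}_n$, where $0\le\underline{s}_n\le\bar{s}_n$, and $\sum_{m\in\mathcal{N}_g,\,m\ne n}\bar{s}_m>D$ for all $n\in\mathcal{N}_g$. (3) There is a supply profile $\bm{s}$ with $\sum_n s_n=D$ that satisfies $\underline{s}_n\le s_n\le\bar{s}_n$ (for all $n\in\mathcal{N}_g$) and $-\bm{f}\le\mathbf{A}_g\bm{s}+\mathbf{A}_\ell\bm{d}\le\bm{f}$ with all inequalities strict. Social optimum. $\bm{s}^*=(s_n^* )_{n\in\mathcal{N}_g}$ is a minimizer of $\sum_{n\in\mathcal{N}_g}c_n(s_n)$ subject to $\sum_{n\in\mathcal{N}_g}s_n=D$, $\underline{s}_n\le s_n\le\bar{s}_n$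 for all $n\in\mathcal{N}_g$, and $-\bm{f}\le\mathbf{A}_g\bm{s}+\mathbf{A}_\ell\bm{d}\le\bm{f}$. Supply function bidding. Each supplier $n\in\mathcal{N}_g$ chooses an action $w_n\ge 0$ and submits the supply function $S_n(p,w_n)=D-w_n/p$. For an action profile $\bm{w}=(w_n)_{n\in\mathcal{N}_g}$ with $\sum_n w_n>0$ the market-clearing price is $p(\bm{w})=\frac{\sum_{n\in\mathcal{N}_g}w_n}{(|\mathcal{N}_g|-1)D}$ (so that $\sum_n S_n[p(\bm{w}),w_n]=D$); the all-zero profile is regarded as infeasible. Supplier $n$'s profit is $u_n(w_n,\bm{w}_{-n})=p(\bm{w})\,S_n[p(\bm{w}),w_n]-c_n(S_n[p(\bm{w}),w_n])$, where $\bm{w}_{-n}$ denotes the actions of the other suppliers. SFE. An action profile $\bm{w}^{**}$ is a supply function equilibrium if for each $n\in\mathcal{N}_g$, $w_n^{**}$ solves: maximize $u_n(w_n,\bm{w}_{-n}^{**})$ over $w_n\ge 0$ subject to $\underline{s}_n\le S_n[p(w_n,\bm{w}_{-n}^{**}),w_n]\le\bar{s}_n$ and $$-\bm{f}\le\mathbf{A}_\ell\bm{d}+[\mathbf{A}_g]_{*n}S_n[p(w_n,\bm{w}_{-n}^{**}),w_n]+\sum_{m\in\mathcal{N}_g,\,m\ne n}[\mathbf{A}_g]_{*m}S_m[p(w_n,\bm{w}_{-n}^{**}),w_m^{**}]\le\bm{f}.$$ The equilibrium supply profile is $\bm{s}^{**}$ with $s_n^{**}=S_n[p(\bm{w}^{**}),w_n^{**}]$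 for an SFE $\bm{w}^{**}$. (The paper states as a separate result that an SFE exists and that all SFEs give the same supply profile, so the PoA is well defined.) Price of anarchy. $\mathrm{PoA}=\sum_{n\in\mathcal{N}_g}c_n(s_n^{**})\big/\sum_{n\in\mathcal{N}_g}c_n(s_n^{*})$. Cycles, partitions, effective flow limits. A cycle is a sequence $n_1,\dots,n_k,n_1$ ($k\ge3$) with $n_1,\dots,n_k$ distinct nodes, consecutive nodes adjacent, and $n_k$ adjacent to $n_1$. For $n\in\mathcal{N}_g$, a partition $\mathcal{P}(n)$ of $\mathcal{N}(n)$ is a set of singletons and two-element subsets (duples) of $\mathcal{N}(n)$ such that: (i) the sets are mutually disjoint with union $\mathcal{N}(n)$; (ii) for every duple $\{i,j\}\in\mathcal{P}(n)$ there is a cycle in which $i,n,j$ (or $j,n,i$) appear consecutively; (iii) for any two distinct singletons $\{i\},\{j\}\in\mathcal{P}(n)$, $i$ and $j$ are not in the same cycle. The mapping $\mathcal{C}_n$ assigns to each duple $\{i,j\}\in\mathcal{P}(n)$ one such cycle containing $i,n,j$ consecutively. The effective flow limit from $n$ to $m\in\mathcal{N}(n)$ is $\hat{f}_{nm}=f_{nm}$ if $\{m\}\in\mathcal{P}(n)$, and, if $\{m,i\}\in\mathcal{P}(n)$ is a duple, $$\hat{f}_{nm}=\min\left\{f_{nm},\ \left(\sum_{\{j,k\}}\frac{f_{jk}}{B_{jk}}\right)B_{nm}\right\},$$ where the sum is over all edges $\{j,k\}\ne\{n,m\}$ of the cycle $\mathcal{C}_n(\{m,i\})$.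
   Formalization: That all supply function equilibria give the same supply profile (so that the PoA is well defined) is a hypothesis here; it can fail when flow limits bind, and then the bound is false for some equilibria. *)

theory Defs
  imports "HOL-Analysis.Analysis" "HOL-Library.Disjoint_Sets"
begin

section \<open>Networked electricity markets\<close>

text \<open>
  A transmission line is the two-element set of its end points, so line data indexed by lines are
  automatically symmetric.  The rows of the shift-factor matrices are indexed by the lines and
  their columns by the generator buses and by all buses, respectively; only these entries of the
  functions are ever used.  The orientation of a line runs from \<open>tail\<close> to \<open>head\<close>.
\<close>

record 'v market =
  buses :: "'v set"
  lines :: "'v set set"
  gens :: "'v set"
  load :: "'v \<Rightarrow> real"
  admittance :: "'v set \<Rightarrow> real"
  flow_limit :: "'v set \<Rightarrow> real"
  tail :: "'v set \<Rightarrow> 'v"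
  head :: "'v set \<Rightarrow> 'v"
  shift_gen :: "'v set \<Rightarrow> 'v \<Rightarrow> real"
  shift_load :: "'v set \<Rightarrow> 'v \<Rightarrow> real"
  cost :: "'v \<Rightarrow> real \<Rightarrow> real"
  supply_min :: "'v \<Rightarrow> real"
  supply_max :: "'v \<Rightarrow> real"

definition neighbors :: "'v market \<Rightarrow> 'v \<Rightarrow> 'v set" where
  "neighbors M n = {m. {n, m} \<in> lines M}"

definition total_load :: "'v market \<Rightarrow> real" where
  "total_load M = (\<Sum>j\<in>buses M. load M j)"

definition line_flows :: "'v market \<Rightarrow> ('v \<Rightarrow> real) \<Rightarrow> ('v \<Rightarrow> 'v \<Rightarrow> real) \<Rightarrow> bool" where
  "line_flows M s p \<longleftrightarrow>
     (\<exists>\<theta>. \<forall>i j. {i, j} \<in> lines M \<longrightarrow> p i j = admittance M {i, j} * (\<theta> i - \<theta> j)) \<and>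
     (\<forall>m\<in>buses M. (\<Sum>i\<in>neighbors M m. p m i) =
        (if m \<in> gens M then s m - load M m else - load M m))"

definition matrix_flow :: "'v market \<Rightarrow> ('v \<Rightarrow> real) \<Rightarrow> 'v set \<Rightarrow> real" where
  "matrix_flow M s e =
     (\<Sum>n\<in>gens M. shift_gen M e n * s n) + (\<Sum>j\<in>buses M. shift_load M e j * load M j)"

definition within_flow_limits :: "'v market \<Rightarrow> ('v \<Rightarrow> real) \<Rightarrow> bool" where
  "within_flow_limits M s \<longleftrightarrow>
     (\<forall>e\<in>lines M. - flow_limit M e \<le> matrix_flow M s e \<and> matrix_flow M s e \<le> flow_limit M e)"

locale electricity_network =
  fixes M :: "'v market"
  assumes finite_buses: "finite (buses M)"
    and lines_simple: "\<And>e. e \<in> lines M \<Longrightarrow> e \<subseteq> buses M \<and> card e = 2"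
    and connected: "\<And>i j. i \<in> buses M \<Longrightarrow> j \<in> buses M \<Longrightarrow> (i, j) \<in> {(u, v). {u, v} \<in> lines M}\<^sup>*"
    and gens_subset: "gens M \<subseteq> buses M"
    and card_gens: "card (gens M) > 2"
    and load_nonneg: "\<And>j. j \<in> buses M \<Longrightarrow> 0 \<le> load M j"
    and total_load_pos: "0 < total_load M"
    and admittance_pos: "\<And>e. e \<in> lines M \<Longrightarrow> 0 < admittance M e"
    and flow_limit_nonneg: "\<And>e. e \<in> lines M \<Longrightarrow> 0 \<le> flow_limit M e"
    and orientation: "\<And>e. e \<in> lines M \<Longrightarrow> e = {tail M e, head M e}"
    and shift_factors: "\<And>s. (\<Sum>n\<in>gens M. s n) = total_load M \<Longrightarrow>
          \<exists>p. line_flows M s p \<and> (\<forall>e\<in>lines M. p (tail M e) (head M e) = matrix_flow M s e)"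

locale electricity_market = electricity_network M
  for M :: "'v market" +
  assumes cost_nonneg: "\<And>n. n \<in> gens M \<Longrightarrow> cost M n \<in> {0..} \<rightarrow> {0..}"
    and cost_convex: "\<And>n. n \<in> gens M \<Longrightarrow> convex_on {0..} (cost M n)"
    and cost_strict_mono: "\<And>n. n \<in> gens M \<Longrightarrow> strict_mono_on {0..} (cost M n)"
    and cost_differentiable: "\<And>n. n \<in> gens M \<Longrightarrow> cost M n differentiable_on {0..}"
    and supply_bounds: "\<And>n. n \<in> gens M \<Longrightarrow> 0 \<le> supply_min M n \<and> supply_min M n \<le> supply_max M n"
    and residual_capacity: "\<And>n. n \<in> gens M \<Longrightarrow> (\<Sum>m\<in>gens M - {n}. supply_max M m) > total_load M"
    and strictly_feasible: "\<exists>s. (\<Sum>n\<in>gens M. s n) = total_load M \<and>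
          (\<forall>n\<in>gens M. supply_min M n < s n \<and> s n < supply_max M n) \<and>
          (\<forall>e\<in>lines M. - flow_limit M e < matrix_flow M s e \<and> matrix_flow M s e < flow_limit M e)"

section \<open>Social optimum and supply function equilibrium\<close>

definition feasible_supply :: "'v market \<Rightarrow> ('v \<Rightarrow> real) \<Rightarrow> bool" where
  "feasible_supply M s \<longleftrightarrow>
     (\<Sum>n\<in>gens M. s n) = total_load M \<and>
     (\<forall>n\<in>gens M. supply_min M n \<le> s n \<and> s n \<le> supply_max M n) \<and>
     within_flow_limits M s"

definition total_cost :: "'v market \<Rightarrow> ('v \<Rightarrow> real) \<Rightarrow> real" where
  "total_cost M s = (\<Sum>n\<in>gens M. cost M n (s n))"

definition social_optimum :: "'v market \<Rightarrow> ('v \<Rightarrow> real) \<Rightarrow> bool" where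
  "social_optimum M s \<longleftrightarrow> is_arg_min (total_cost M) (feasible_supply M) s"

definition supply_function :: "'v market \<Rightarrow> real \<Rightarrow> real \<Rightarrow> real" where
  "supply_function M p x = total_load M - x / p"

definition clearing_price :: "'v market \<Rightarrow> ('v \<Rightarrow> real) \<Rightarrow> real" where
  "clearing_price M w = (\<Sum>n\<in>gens M. w n) / ((real (card (gens M)) - 1) * total_load M)"

definition supply_profile :: "'v market \<Rightarrow> ('v \<Rightarrow> real) \<Rightarrow> 'v \<Rightarrow> real" where
  "supply_profile M w n = supply_function M (clearing_price M w) (w n)"

definition profit :: "'v market \<Rightarrow> 'v \<Rightarrow> ('v \<Rightarrow> real) \<Rightarrow> real" where
  "profit M n w = clearing_price M w * supply_profile M w n - cost M n (supply_profile M w n)"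

text \<open>
  The constraints of supplier \<open>n\<close> at the action profile \<open>w\<close>.  They contain the capacity limits of
  \<open>n\<close> only, but all flow limits.  Positivity of the sum excludes the all-zero profile, at which no
  price is defined.
\<close>

definition admissible_action :: "'v market \<Rightarrow> 'v \<Rightarrow> ('v \<Rightarrow> real) \<Rightarrow> bool" where
  "admissible_action M n w \<longleftrightarrow>
     0 \<le> w n \<and> 0 < (\<Sum>m\<in>gens M. w m) \<and>
     supply_min M n \<le> supply_profile M w n \<and> supply_profile M w n \<le> supply_max M n \<and>
     within_flow_limits M (supply_profile M w)"

definition supply_function_equilibrium :: "'v market \<Rightarrow> ('v \<Rightarrow> real) \<Rightarrow> bool" where
  "supply_function_equilibrium M w \<longleftrightarrow>
     (\<forall>n\<in>gens M. is_arg_max (\<lambda>x. profit M n (w(n := x))) (\<lambda>x. admissible_action M n (w(n := x))) (w n))"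

text \<open>
  \<open>s\<close> is \<^emph>\<open>the\<close> equilibrium supply profile: some equilibrium induces it, and every equilibrium does.
  The second half is what makes the price of anarchy a well-defined number.
\<close>

definition equilibrium_supply :: "'v market \<Rightarrow> ('v \<Rightarrow> real) \<Rightarrow> bool" where
  "equilibrium_supply M s \<longleftrightarrow>
     (\<exists>w. supply_function_equilibrium M w) \<and>
     (\<forall>w. supply_function_equilibrium M w \<longrightarrow> (\<forall>n\<in>gens M. s n = supply_profile M w n))"

definition price_of_anarchy :: "'v market \<Rightarrow> ('v \<Rightarrow> real) \<Rightarrow> ('v \<Rightarrow> real) \<Rightarrow> real" where
  "price_of_anarchy M s_eq s_opt = total_cost M s_eq / total_cost M s_opt"

section \<open>Cycles, partitions and effective flow limits\<close>

text \<open>A cycle \<open>n\<^sub>1, \<dots>, n\<^sub>k, n\<^sub>1\<close> is the list of its distinct nodes \<open>n\<^sub>1, \<dots>, n\<^sub>k\<close>.\<close>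

definition cycle_line :: "'v list \<Rightarrow> nat \<Rightarrow> 'v set" where
  "cycle_line ns k = {ns ! k, ns ! (Suc k mod length ns)}"

definition cycle_lines :: "'v list \<Rightarrow> 'v set set" where
  "cycle_lines ns = cycle_line ns ` {..<length ns}"

definition is_cycle :: "'v market \<Rightarrow> 'v list \<Rightarrow> bool" where
  "is_cycle M ns \<longleftrightarrow> 3 \<le> length ns \<and> distinct ns \<and> cycle_lines ns \<subseteq> lines M"

definition consecutive :: "'v list \<Rightarrow> 'v \<Rightarrow> 'v \<Rightarrow> 'v \<Rightarrow> bool" where
  "consecutive ns i n j \<longleftrightarrow>
     (\<exists>k<length ns. ns ! k = i \<and> ns ! (Suc k mod length ns) = n \<and> ns ! (Suc (Suc k) mod length ns) = j)"

definition cycle_through :: "'v market \<Rightarrow> 'v \<Rightarrow> 'v \<Rightarrow> 'v \<Rightarrow> 'v list \<Rightarrow> bool" where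
  "cycle_through M i n j ns \<longleftrightarrow> is_cycle M ns \<and> (consecutive ns i n j \<or> consecutive ns j n i)"

definition neighbor_partition :: "'v market \<Rightarrow> 'v \<Rightarrow> 'v set set \<Rightarrow> bool" where
  "neighbor_partition M n P \<longleftrightarrow>
     (\<forall>X\<in>P. card X = 1 \<or> card X = 2) \<and>
     partition_on (neighbors M n) P \<and>
     (\<forall>i j. i \<noteq> j \<and> {i, j} \<in> P \<longrightarrow> (\<exists>ns. cycle_through M i n j ns)) \<and>
     (\<forall>i j. i \<noteq> j \<and> {i} \<in> P \<and> {j} \<in> P \<longrightarrow> (\<nexists>ns. is_cycle M ns \<and> i \<in> set ns \<and> j \<in> set ns))"

definition cycle_mapping :: "'v market \<Rightarrow> 'v \<Rightarrow> 'v set set \<Rightarrow> ('v set \<Rightarrow> 'v list) \<Rightarrow> bool" where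
  "cycle_mapping M n P C \<longleftrightarrow> (\<forall>i j. i \<noteq> j \<and> {i, j} \<in> P \<longrightarrow> cycle_through M i n j (C {i, j}))"

definition effective_flow_limit ::
    "'v market \<Rightarrow> 'v set set \<Rightarrow> ('v set \<Rightarrow> 'v list) \<Rightarrow> 'v \<Rightarrow> 'v \<Rightarrow> real" where
  "effective_flow_limit M P C n m =
     (if {m} \<in> P then flow_limit M {n, m}
      else let X = (THE X. X \<in> P \<and> m \<in> X)
           in min (flow_limit M {n, m})
                ((\<Sum>e\<in>cycle_lines (C X) - {{n, m}}. flow_limit M e / admittance M e) * admittance M {n, m}))"

end

theory Submission
  imports Defs
begin

text \<open>
  A unilateral deviation of supplier \<open>n\<close> moves the supply profile \<open>s\<close> along the direction
  \<open>e\<^sub>n - q\<close>, where \<open>q\<close> is the probability vector with entries \<open>(D - s\<^sub>m) / ((|N| - 1) D)\<close>, and it pays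
  exactly when the price exceeds (or falls below) the marked-up marginal cost
  \<open>c\<^sub>n'(s\<^sub>n) (1 + s\<^sub>n / ((|N| - 2) D))\<close>. Let \<open>s\<close> minimize the sum of the corresponding bid costs. If \<open>n\<close> can
  deviate upwards and \<open>m\<close> downwards, then the flow limits leave room along \<open>e\<^sub>n - e\<^sub>m\<close>, because \<open>q\<close>
  cancels, so by minimality the marked-up marginal of \<open>m\<close> is at most that of \<open>n\<close>. Hence one price
  separates the two groups and turns \<open>s\<close> into an equilibrium, without any multipliers. The
  price must be positive, which is arranged by minimizing over slightly raised lower capacity limits.

  As all equilibria induce the same supplies, the equilibrium supply has a bid cost of at most that of
  each feasible profile strictly above the lower limits, and in the limit at most that of the
  social optimum. Since \<open>c\<^sub>n(x) \<le> bid_cost(x) \<le> c\<^sub>n(x) (1 + x / ((|N| - 2) D))\<close>, it remains to bound the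
  optimal supply of \<open>n\<close>. Its excess over the local load leaves through the lines at \<open>n\<close>, and on a line
  of a cycle the angle difference is at most the sum of those that the other lines allow.
\<close>

section \<open>One-sided derivatives\<close>

lemma nonneg_derivative_if_right_min:
  fixes f :: "real \<Rightarrow> real"
  assumes "(f has_real_derivative D) (at x within S)" "0 < e"
    and "\<And>h. 0 < h \<Longrightarrow> h < e \<Longrightarrow> x + h \<in> S \<and> f x \<le> f (x + h)"
  shows "0 \<le> D"
proof (rule ccontr)
  assume "\<not> 0 \<le> D"
  then obtain d where d: "d > 0" "\<forall>h>0. x + h \<in> S \<longrightarrow> h < d \<longrightarrow> f x > f (x + h)"
    using has_real_derivative_neg_dec_right[OF assms(1)] by auto
  define h where "h = min d e / 2"
  have "0 < h" "h < d" "h < e" using d assms(2) by (auto simp: h_def)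
  then show False using d assms(3)[of h] by force
qed

text \<open>Darboux's theorem with one-sided derivatives at the end points: a minimum of
  \<open>f x - y * x\<close> has slope zero. Marginal costs can thus be prescribed without a
  continuity argument.\<close>

lemma derivative_intermediate_value:
  fixes f f' :: "real \<Rightarrow> real"
  assumes "a \<le> b"
    and der: "\<And>x. x \<in> {a..b} \<Longrightarrow> (f has_real_derivative f' x) (at x within {a..b})"
    and "f' a \<le> y" "y \<le> f' b"
  obtains x where "x \<in> {a..b}" "f' x = y"
proof (cases "f' a = y \<or> f' b = y")
  case True
  then show thesis using that \<open>a \<le> b\<close> by auto
next
  case False
  then have ends: "f' a < y" "y < f' b" using assms by auto
  define g where "g = (\<lambda>x. f x - y * x)"
  have g: "(g has_real_derivative f' x - y) (at x within {a..b})" if "x \<in> {a..b}" for x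
    unfolding g_def using der[OF that] by (auto intro!: derivative_eq_intros)
  have "continuous_on {a..b} g"
    using g by (meson DERIV_continuous continuous_on_eq_continuous_within)
  then obtain z where z: "z \<in> {a..b}" "\<And>x. x \<in> {a..b} \<Longrightarrow> g z \<le> g x"
    using continuous_attains_inf[of "{a..b}" g] \<open>a \<le> b\<close> by auto
  have "\<not> f' z < y"
  proof
    assume less: "f' z < y"
    then have "z < b" using z ends by (cases "z = b") auto
    moreover have "0 \<le> f' z - y"
      using z by (intro nonneg_derivative_if_right_min[OF g[OF z(1)], of "b - z"])
        (use \<open>z < b\<close> in auto)
    ultimately show False using less by simp
  qed
  moreover have "\<not> f' z > y"
  proof
    assume less: "f' z > y"
    then have "a < z" using z ends by (cases "z = a") auto
    obtain d where d: "d > 0" "\<forall>h>0. z - h \<in> {a..b} \<longrightarrow> h < d \<longrightarrow> g (z - h) < g z"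
      using has_real_derivative_pos_inc_left[OF g[OF z(1)]] less by auto
    define h where "h = min d (z - a) / 2"
    have "0 < h" "h < d" "h < z - a" using d \<open>a < z\<close> by (auto simp: h_def)
    then have "z - h \<in> {a..b}" using z by auto
    then show False using d z(2)[of "z - h"] \<open>0 < h\<close> \<open>h < d\<close> by force
  qed
  ultimately show thesis using that z(1) by force
qed

text \<open>Along the segment from \<open>x\<close> to \<open>y\<close> the chord minus
  \<open>f\<close> is smallest at \<open>x\<close>, so its one-sided slope there is nonnegative.
  This covers boundary points of \<open>S\<close>, such as zero supply.\<close>

lemma convex_on_above_tangent_within:
  fixes f :: "real \<Rightarrow> real"
  assumes "convex_on S f" "x \<in> S" "y \<in> S" "(f has_real_derivative d) (at x within S)"
  shows "d * (y - x) \<le> f y - f x"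
proof -
  define g where "g = (\<lambda>t. x + t * (y - x))"
  have g01: "g t = (1 - t) *\<^sub>R x + t *\<^sub>R y" for t by (simp add: g_def algebra_simps)
  have img: "g ` {0..1} \<subseteq> S"
    using assms(1-3) by (auto simp: g01 convex_on_def convex_def)
  have "(g has_real_derivative (y - x)) (at 0 within {0..1})"
    unfolding g_def by (auto intro!: derivative_eq_intros)
  moreover have "(f has_real_derivative d) (at (g 0) within g ` {0..1})"
    using DERIV_subset[OF assms(4) img] by (simp add: g_def)
  ultimately have "((\<lambda>t. f (g t)) has_real_derivative d * (y - x)) (at 0 within {0..1})"
    using DERIV_image_chain[of f d g 0 "{0..1}" "y - x"] by (simp add: o_def)
  then have "((\<lambda>t. t * (f y - f x) - f (g t)) has_real_derivative (f y - f x) - d * (y - x))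
      (at 0 within {0..1})"
    by (auto intro!: derivative_eq_intros)
  then have "0 \<le> (f y - f x) - d * (y - x)"
  proof (rule nonneg_derivative_if_right_min[where e = 1])
    fix h :: real assume h: "0 < h" "h < 1"
    have "f (g h) \<le> (1 - h) * f x + h * f y"
      using convex_onD[OF assms(1), of h x y] assms h by (simp add: g01)
    then show "0 + h \<in> {0..1} \<and> 0 * (f y - f x) - f (g 0) \<le> (0 + h) * (f y - f x) - f (g (0 + h))"
      using h by (simp add: g_def algebra_simps)
  qed simp
  then show ?thesis by simp
qed

lemma integral_has_real_derivative_atLeast:
  fixes f :: "real \<Rightarrow> real"
  assumes "continuous_on {a..} f" "a \<le> x"
  shows "((\<lambda>x. integral {a..x} f) has_real_derivative f x) (at x within {a..})"
proof -
  have "((\<lambda>x. integral {a..x} f) has_real_derivative f x) (at x within {a..x + 1})"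
    using assms by (intro integral_has_real_derivative) (auto intro: continuous_on_subset)
  moreover have "at x within {a..x + 1} = at x within {a..}"
    by (rule at_within_nhd[of _ "{..<x + 1}"]) auto
  ultimately show ?thesis by simp
qed

section \<open>Bid costs and unilateral deviations\<close>

text \<open>The denominator in the bound; in \<open>deviation\<close> the own supply of
  \<open>n\<close> changes by \<open>\<rho> * (markup_base M + s n)\<close>.\<close>

definition markup_base :: "'v market \<Rightarrow> real" where
  "markup_base M = (real (card (gens M)) - 2) * total_load M"

definition marginal_cost :: "'v market \<Rightarrow> 'v \<Rightarrow> real \<Rightarrow> real" where
  "marginal_cost M n x = (SOME d. (cost M n has_real_derivative d) (at x within {0..}))"

text \<open>
  The derivative of \<open>bid_cost\<close> is the marginal cost with the markup factor \<open>1 + x / markup_base M\<close>,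
  the threshold that the price has to exceed for a supplier to gain from producing more than \<open>x\<close>.
\<close>

definition bid_cost :: "'v market \<Rightarrow> 'v \<Rightarrow> real \<Rightarrow> real" where
  "bid_cost M n x =
     cost M n x * (1 + x / markup_base M) - integral {0..x} (cost M n) / markup_base M"

definition bid_marginal :: "'v market \<Rightarrow> 'v \<Rightarrow> real \<Rightarrow> real" where
  "bid_marginal M n x = marginal_cost M n x * (1 + x / markup_base M)"

text \<open>
  The supplies after \<open>n\<close> alone has changed its action so that the price is divided by \<open>1 + \<rho>\<close>: then
  \<open>total_load M - s m\<close> is multiplied by \<open>1 + \<rho>\<close> for every \<open>m\<close> other than \<open>n\<close>.
\<close>

definition deviation :: "'v market \<Rightarrow> ('v \<Rightarrow> real) \<Rightarrow> 'v \<Rightarrow> real \<Rightarrow> 'v \<Rightarrow> real" where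
  "deviation M s n \<rho> m =
     s m + \<rho> * ((if m = n then (real (card (gens M)) - 1) * total_load M else 0)
       - (total_load M - s m))"

lemma matrix_flow_affine:
  "matrix_flow M (\<lambda>i. (1 - u) * s i + u * s' i) e = (1 - u) * matrix_flow M s e + u * matrix_flow M s' e"
  by (simp add: matrix_flow_def algebra_simps sum.distrib sum_distrib_left sum_subtractf)

lemma within_flow_limits_convex:
  assumes "within_flow_limits M s" "within_flow_limits M s'" "0 \<le> u" "u \<le> 1"
  shows "within_flow_limits M (\<lambda>i. (1 - u) * s i + u * s' i)"
  unfolding within_flow_limits_def matrix_flow_affine
proof (intro ballI conjI)
  fix e assume e: "e \<in> lines M"
  have 1: "- flow_limit M e \<le> matrix_flow M s e" "matrix_flow M s e \<le> flow_limit M e"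
    and 2: "- flow_limit M e \<le> matrix_flow M s' e" "matrix_flow M s' e \<le> flow_limit M e"
    using assms(1,2) e by (auto simp: within_flow_limits_def)
  show "- flow_limit M e \<le> (1 - u) * matrix_flow M s e + u * matrix_flow M s' e"
    using mult_left_mono[OF 1(1), of "1 - u"] mult_left_mono[OF 2(1), of u] assms(3,4)
    by (simp add: algebra_simps)
  show "(1 - u) * matrix_flow M s e + u * matrix_flow M s' e \<le> flow_limit M e"
    using mult_left_mono[OF 1(2), of "1 - u"] mult_left_mono[OF 2(2), of u] assms(3,4)
    by (simp add: algebra_simps)
qed

lemma within_flow_limits_cong:
  assumes "\<And>n. n \<in> gens M \<Longrightarrow> s n = s' n"
  shows "within_flow_limits M s = within_flow_limits M s'"
  using assms by (simp add: within_flow_limits_def matrix_flow_def)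

text \<open>\<open>deviation\<close> is affine in \<rho>, so the scaled one is a convex combination
  of \<open>s\<close> and the full one.\<close>

lemma within_flow_limits_deviation_shrink:
  assumes "within_flow_limits M s" "within_flow_limits M (deviation M s n \<rho>)" "0 \<le> u" "u \<le> 1"
  shows "within_flow_limits M (deviation M s n (u * \<rho>))"
proof -
  have "deviation M s n (u * \<rho>) = (\<lambda>i. (1 - u) * s i + u * deviation M s n \<rho> i)"
    by (auto simp: deviation_def algebra_simps)
  then show ?thesis using within_flow_limits_convex[OF assms] by simp
qed

section \<open>Unilateral deviations in the network\<close>

context electricity_network
begin

lemma finite_gens: "finite (gens M)"
  using finite_buses gens_subset by (rule finite_subset[rotated])

lemma gens_nonempty: "gens M \<noteq> {}"
  using card_gens by auto

lemma markup_base_pos: "0 < markup_base M"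
  unfolding markup_base_def using card_gens total_load_pos by (intro mult_pos_pos) auto

lemma supply_le_total_load:
  assumes "(\<Sum>n\<in>gens M. s n) = total_load M" "\<And>n. n \<in> gens M \<Longrightarrow> 0 \<le> s n" "n \<in> gens M"
  shows "s n \<le> total_load M"
  using member_le_sum[of n "gens M" s] assms finite_gens by auto

text \<open>
  Moving \<open>n\<close> up and \<open>m\<close> down by unilateral deviations cancels the responses of the other suppliers.
\<close>

lemma within_flow_limits_transfer:
  assumes "within_flow_limits M s" "n \<noteq> m"
    and n: "0 < \<rho>" "within_flow_limits M (deviation M s n \<rho>)"
    and m: "0 < \<sigma>" "within_flow_limits M (deviation M s m (- \<sigma>))"
  obtains \<tau> where "0 < \<tau>" "within_flow_limits M (s(n := s n + \<tau>, m := s m - \<tau>))"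
proof -
  \<comment> \<open>With equal step sizes the responses of the other suppliers are opposite;
    shrinking keeps both deviations feasible.\<close>
  define \<mu> where "\<mu> = min \<rho> \<sigma>"
  have \<mu>: "0 < \<mu>" "\<mu> \<le> \<rho>" "\<mu> \<le> \<sigma>" using n m by (auto simp: \<mu>_def)
  have 1: "within_flow_limits M (deviation M s n \<mu>)"
    using within_flow_limits_deviation_shrink[OF assms(1) n(2), of "\<mu> / \<rho>"] \<mu> n(1) by simp
  have 2: "within_flow_limits M (deviation M s m (- \<mu>))"
    using within_flow_limits_deviation_shrink[OF assms(1) m(2), of "\<mu> / \<sigma>"] \<mu> m(1) by simp
  \<comment> \<open>In the average of the two deviations the terms \<open>total_load M - s i\<close>
    cancel, and half of the direct change of \<open>n\<close> and \<open>m\<close> remains.\<close>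
  define \<tau> where "\<tau> = \<mu> / 2 * ((real (card (gens M)) - 1) * total_load M)"
  have "(\<lambda>i. (1 - 1 / 2) * deviation M s n \<mu> i + 1 / 2 * deviation M s m (- \<mu>) i) =
      s(n := s n + \<tau>, m := s m - \<tau>)"
    using \<open>n \<noteq> m\<close> by (auto simp: deviation_def \<tau>_def field_simps)
  then have "within_flow_limits M (s(n := s n + \<tau>, m := s m - \<tau>))"
    using within_flow_limits_convex[OF 1 2, of "1/2"] by simp
  moreover have "0 < \<tau>"
    unfolding \<tau>_def using \<mu>(1) card_gens total_load_pos by (intro mult_pos_pos) auto
  ultimately show thesis by (rule that[rotated])
qed

text \<open>The bids \<open>w\<close> clear at price \<open>p\<close>. At a new price
  \<open>p'\<close> the unchanged bid of \<open>m\<close> yields the supply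
  \<open>total_load M - p / p' * (total_load M - s m)\<close>, so 1 + \<rho> is
  \<open>p / p'\<close>; market clearing then fixes the supply of \<open>n\<close>.\<close>

lemma supply_profile_deviation:
  assumes s: "(\<Sum>n\<in>gens M. s n) = total_load M"
    and w: "w = (\<lambda>m. p * (total_load M - s m))" and "0 < p" "n \<in> gens M"
    and pos: "0 < (\<Sum>m\<in>gens M. (w(n := x)) m)" and "m \<in> gens M"
  shows "supply_profile M (w(n := x)) m = deviation M s n (p / clearing_price M (w(n := x)) - 1) m"
proof -
  let ?D = "total_load M" and ?N = "real (card (gens M))"
  define p' where "p' = clearing_price M (w(n := x))"
  have den: "0 < (?N - 1) * ?D" using card_gens total_load_pos by (intro mult_pos_pos) auto
  have "0 < p'" unfolding p'_def clearing_price_def using pos den by (rule divide_pos_pos)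
  have "(\<Sum>m\<in>gens M. (w(n := x)) m) = x + (\<Sum>m\<in>gens M - {n}. w m)"
    using \<open>n \<in> gens M\<close> finite_gens by (simp add: sum.remove)
  also have "(\<Sum>m\<in>gens M - {n}. w m) = (\<Sum>m\<in>gens M. w m) - w n"
    using \<open>n \<in> gens M\<close> finite_gens by (simp add: sum_diff1)
  also have "(\<Sum>m\<in>gens M. w m) = p * ((?N - 1) * ?D)"
    using s by (simp add: w sum_subtractf flip: sum_distrib_left) (simp add: algebra_simps)
  finally have "(\<Sum>m\<in>gens M. (w(n := x)) m) = x + (p * ((?N - 1) * ?D) - w n)" .
  moreover have "p' * ((?N - 1) * ?D) = (\<Sum>m\<in>gens M. (w(n := x)) m)"
    unfolding p'_def clearing_price_def using den by (metis less_irrefl nonzero_eq_divide_eq)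
  ultimately have "p' * ((?N - 1) * ?D) = x + (p * ((?N - 1) * ?D) - p * (?D - s n))"
    by (simp add: w)
  then have x: "x = p' * ((?N - 1) * ?D) - p * ((?N - 1) * ?D) + p * (?D - s n)" by simp
  show ?thesis
  proof (cases "m = n")
    case True
    have "x / p' = (?N - 1) * ?D - p / p' * ((?N - 1) * ?D) + p / p' * (?D - s n)"
      unfolding x using \<open>0 < p'\<close> by (simp add: add_divide_distrib diff_divide_distrib)
    then show ?thesis
      using True unfolding p'_def[symmetric] supply_profile_def supply_function_def deviation_def
      by (simp add: algebra_simps)
  next
    case False
    then show ?thesis
      unfolding p'_def[symmetric] supply_profile_def supply_function_def deviation_def
      by (simp add: w algebra_simps diff_divide_distrib)
  qed
qed

end

section \<open>Marginal costs and bid costs\<close>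

context electricity_market
begin

lemma marginal_cost:
  assumes "n \<in> gens M" "0 \<le> x"
  shows "(cost M n has_real_derivative marginal_cost M n x) (at x within {0..})"
proof -
  have "\<exists>d. (cost M n has_real_derivative d) (at x within {0..})"
    using cost_differentiable[OF assms(1)] assms(2)
    by (auto simp: differentiable_on_def real_differentiable_def)
  then show ?thesis unfolding marginal_cost_def by (rule someI_ex)
qed

lemma cost_continuous: "n \<in> gens M \<Longrightarrow> continuous_on {0..} (cost M n)"
  using cost_differentiable differentiable_imp_continuous_on by blast

lemma marginal_cost_tangent:
  assumes "n \<in> gens M" "0 \<le> x" "0 \<le> y"
  shows "marginal_cost M n x * (y - x) \<le> cost M n y - cost M n x"
  using assms by (intro convex_on_above_tangent_within[OF cost_convex _ _ marginal_cost]) auto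

lemma cost_less: "n \<in> gens M \<Longrightarrow> 0 \<le> x \<Longrightarrow> x < y \<Longrightarrow> cost M n x < cost M n y"
  using cost_strict_mono by (auto simp: strict_mono_on_def)

lemma cost_ge_0: "n \<in> gens M \<Longrightarrow> 0 \<le> x \<Longrightarrow> 0 \<le> cost M n x"
  using cost_nonneg by (auto simp: Pi_iff)

lemma marginal_cost_nonneg:
  assumes "n \<in> gens M" "0 \<le> x"
  shows "0 \<le> marginal_cost M n x"
  using assms cost_less[OF assms(1)]
  by (intro nonneg_derivative_if_right_min[OF marginal_cost[OF assms], of 1]) (auto intro: less_imp_le)

lemma marginal_cost_mono:
  assumes "n \<in> gens M" "0 \<le> x" "x \<le> y"
  shows "marginal_cost M n x \<le> marginal_cost M n y"
proof (cases "x = y")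
  case False
  have "marginal_cost M n x * (y - x) \<le> marginal_cost M n y * (y - x)"
    using marginal_cost_tangent[of n x y] marginal_cost_tangent[of n y x] assms
    by (simp add: algebra_simps)
  then show ?thesis using False assms by simp
qed simp

text \<open>The tangent at \<open>x\<close> lies at 0 below the cost of 0, which is strictly below
  the cost of \<open>x\<close>.\<close>

lemma marginal_cost_pos:
  assumes "n \<in> gens M" "0 < x"
  shows "0 < marginal_cost M n x"
proof -
  have "marginal_cost M n x * (0 - x) < 0"
    using marginal_cost_tangent[of n x 0] cost_less[of n 0 x] assms by simp
  then show ?thesis using assms by (simp add: zero_less_mult_iff)
qed

text \<open>The integral in \<open>bid_cost\<close> cancels the term
  \<open>cost M n x / markup_base M\<close> of the product rule.\<close>

lemma bid_marginal:
  assumes "n \<in> gens M" "0 \<le> x"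
  shows "(bid_cost M n has_real_derivative bid_marginal M n x) (at x within {0..})"
  unfolding bid_cost_def[abs_def] bid_marginal_def using assms markup_base_pos
  by (auto intro!: derivative_eq_intros marginal_cost cost_continuous
      integral_has_real_derivative_atLeast)

lemma bid_cost_continuous: "n \<in> gens M \<Longrightarrow> continuous_on {0..} (bid_cost M n)"
  by (rule DERIV_continuous_on[OF bid_marginal]) auto

lemma bid_marginal_pos: "n \<in> gens M \<Longrightarrow> 0 < x \<Longrightarrow> 0 < bid_marginal M n x"
  unfolding bid_marginal_def using marginal_cost_pos markup_base_pos
  by (intro mult_pos_pos) (auto intro: add_pos_pos)

lemma bid_marginal_mono:
  assumes "n \<in> gens M" "0 \<le> x" "x \<le> y"
  shows "bid_marginal M n x \<le> bid_marginal M n y"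
  unfolding bid_marginal_def using assms markup_base_pos
  by (intro mult_mono marginal_cost_mono marginal_cost_nonneg) (auto simp: divide_right_mono)

text \<open>As costs increase, the integral is at most \<open>x * cost M n x\<close>, so no more is
  subtracted than the markup adds.\<close>

lemma cost_le_bid_cost:
  assumes "n \<in> gens M" "0 \<le> x"
  shows "cost M n x \<le> bid_cost M n x"
proof -
  have "cost M n integrable_on {0..x}"
    using cost_continuous[OF assms(1)]
    by (intro integrable_continuous_real) (auto intro: continuous_on_subset)
  then have "integral {0..x} (cost M n) \<le> integral {0..x} (\<lambda>_. cost M n x)"
    using cost_less[OF assms(1)] by (intro integral_le) (auto simp: le_less)
  then have "integral {0..x} (cost M n) / markup_base M \<le> cost M n x * (x / markup_base M)"
    using assms markup_base_pos by (simp add: divide_right_mono mult.commute)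
  then show ?thesis by (simp add: bid_cost_def algebra_simps)
qed

text \<open>Costs are nonnegative, hence so is the subtracted integral.\<close>

lemma bid_cost_le:
  assumes "n \<in> gens M" "0 \<le> x"
  shows "bid_cost M n x \<le> cost M n x * (1 + x / markup_base M)"
proof -
  have "cost M n integrable_on {0..x}"
    using cost_continuous[OF assms(1)]
    by (intro integrable_continuous_real) (auto intro: continuous_on_subset)
  then have "0 \<le> integral {0..x} (cost M n)"
    using cost_ge_0[OF assms(1)] by (intro integral_nonneg) auto
  then show ?thesis using markup_base_pos by (simp add: bid_cost_def)
qed

end

section \<open>Equilibria from minimizers of the bid cost\<close>

context electricity_market
begin

text \<open>If a new bid of \<open>n\<close> changes the price from
  \<open>p = (1 + \<rho>) * p'\<close> to \<open>p'\<close>, the revenue of \<open>n\<close> changes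
  by \<open>markup_base M * \<rho> * p'\<close> and, by convexity, its cost by at least
  \<open>markup_base M * \<rho> * bid_marginal M n (s n)\<close>. It remains to compare
  \<open>p'\<close> with this marginal.\<close>

lemma equilibrium_if_price_supports:
  assumes p: "0 < p"
    and total: "(\<Sum>n\<in>gens M. s n) = total_load M"
    and bounds: "\<And>n. n \<in> gens M \<Longrightarrow> supply_min M n \<le> s n \<and> s n \<le> supply_max M n"
    and flow: "within_flow_limits M s"
    and up: "\<And>n \<rho>. n \<in> gens M \<Longrightarrow> 0 < \<rho> \<Longrightarrow> within_flow_limits M (deviation M s n \<rho>) \<Longrightarrow>
      s n < supply_max M n \<Longrightarrow> p \<le> bid_marginal M n (s n)"
    and down: "\<And>n \<rho>. n \<in> gens M \<Longrightarrow> 0 < \<rho> \<Longrightarrow> within_flow_limits M (deviation M s n (- \<rho>)) \<Longrightarrow>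
      supply_min M n < s n \<Longrightarrow> bid_marginal M n (s n) \<le> p"
    and w: "w = (\<lambda>m. p * (total_load M - s m))"
  shows "supply_function_equilibrium M w"
    and "\<And>n. n \<in> gens M \<Longrightarrow> supply_profile M w n = s n"
proof -
  let ?D = "total_load M" and ?N = "real (card (gens M))" and ?\<kappa> = "markup_base M"
  have s0: "0 \<le> s n" if "n \<in> gens M" for n using bounds[OF that] supply_bounds[OF that] by simp
  have den: "0 < (?N - 1) * ?D" using card_gens total_load_pos by (intro mult_pos_pos) auto
  have w_sum: "(\<Sum>m\<in>gens M. w m) = p * ((?N - 1) * ?D)"
    using total by (simp add: w sum_subtractf flip: sum_distrib_left) (simp add: algebra_simps)
  have price: "clearing_price M w = p"
    unfolding clearing_price_def w_sum using den by (metis less_irrefl nonzero_mult_div_cancel_right)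
  have w_pos: "0 < (\<Sum>m\<in>gens M. w m)" unfolding w_sum using p den by (rule mult_pos_pos)
  show profile: "supply_profile M w n = s n" if "n \<in> gens M" for n
    unfolding supply_profile_def supply_function_def price using p by (simp add: w)
  show "supply_function_equilibrium M w"
    unfolding supply_function_equilibrium_def is_arg_max_def
  proof (intro ballI conjI notI)
    fix n assume n: "n \<in> gens M"
    have "0 \<le> w n" using supply_le_total_load[OF total s0 n] p by (simp add: w)
    moreover have "within_flow_limits M (supply_profile M w)"
      using within_flow_limits_cong[of M "supply_profile M w" s] profile flow by blast
    ultimately show "admissible_action M n (w(n := w n))"
      using w_pos profile[OF n] bounds[OF n] by (simp add: admissible_action_def)
  next
    fix n assume n: "n \<in> gens M"
      and "\<exists>x. admissible_action M n (w(n := x)) \<and> profit M n (w(n := w n)) < profit M n (w(n := x))"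
    then obtain x where adm: "admissible_action M n (w(n := x))"
      and better: "profit M n w < profit M n (w(n := x))" by auto
    define p' where "p' = clearing_price M (w(n := x))"
    define \<rho> where "\<rho> = p / p' - 1"
    define t where "t = deviation M s n \<rho> n"
    have x_pos: "0 < (\<Sum>m\<in>gens M. (w(n := x)) m)" using adm by (simp add: admissible_action_def)
    then have p': "0 < p'" unfolding p'_def clearing_price_def using den by (rule divide_pos_pos)
    have dev: "supply_profile M (w(n := x)) m = deviation M s n \<rho> m" if "m \<in> gens M" for m
      unfolding \<rho>_def p'_def using supply_profile_deviation[OF total w p n x_pos that] .
    have p_eq: "p = (1 + \<rho>) * p'" using p' by (simp add: \<rho>_def)
    have t_eq: "t = s n + \<rho> * (?\<kappa> + s n)"
      by (simp add: t_def deviation_def markup_base_def algebra_simps)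
    have t_bounds: "supply_min M n \<le> t" "t \<le> supply_max M n"
      using adm dev[OF n] by (auto simp: admissible_action_def t_def)
    then have t0: "0 \<le> t" using supply_bounds[OF n] by simp
    have dev_flow: "within_flow_limits M (deviation M s n \<rho>)"
      using adm within_flow_limits_cong[of M "supply_profile M (w(n := x))"] dev
      by (auto simp: admissible_action_def)
    have \<kappa>s: "0 < ?\<kappa> + s n" using markup_base_pos s0[OF n] by simp
    \<comment> \<open>An upward deviation lowers the price and a downward one raises it, so the
      comparisons of \<open>p\<close> with the marginal carry over to \<open>p'\<close>.\<close>
    have "\<rho> * p' \<le> \<rho> * bid_marginal M n (s n)"
    proof (cases \<rho> "0::real" rule: linorder_cases)
      case greater
      then have "s n < supply_max M n" using t_bounds(2) \<kappa>s by (simp add: t_eq) (smt (verit) mult_pos_pos)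
      then have "p \<le> bid_marginal M n (s n)" using up[OF n greater dev_flow] by simp
      moreover have "p' \<le> p" using greater p' by (simp add: p_eq)
      ultimately show ?thesis using greater by simp
    next
      case less
      then have "supply_min M n < s n"
        using t_bounds(1) \<kappa>s mult_neg_pos[of \<rho> "?\<kappa> + s n"] by (simp add: t_eq)
      then have "bid_marginal M n (s n) \<le> p" using down[OF n, of "- \<rho>"] less dev_flow by simp
      moreover have "p \<le> p'" using less p' by (simp add: p_eq)
      ultimately show ?thesis using less by simp
    qed simp
    then have "?\<kappa> * (\<rho> * p') \<le> ?\<kappa> * (\<rho> * bid_marginal M n (s n))"
      using markup_base_pos by simp
    also have "\<dots> = marginal_cost M n (s n) * (t - s n)"
      using markup_base_pos by (simp add: bid_marginal_def t_eq field_simps)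
    also have "\<dots> \<le> cost M n t - cost M n (s n)"
      using marginal_cost_tangent[OF n s0[OF n] t0] .
    finally have "p' * t - p * s n \<le> cost M n t - cost M n (s n)"
      by (simp add: t_eq p_eq algebra_simps)
    moreover have "profit M n w = p * s n - cost M n (s n)"
      using profile[OF n] by (simp add: profit_def price)
    moreover have "profit M n (w(n := x)) = p' * t - cost M n t"
      using dev[OF n] by (simp add: profit_def p'_def t_def)
    ultimately show False using better by simp
  qed
qed

text \<open>Entries outside \<open>gens M\<close> are fixed to 0 so that the set lies in a product
  of compact sets, to which Tychonoff's theorem applies.\<close>

lemma compact_supplies:
  "compact {s. (\<forall>i. s i \<in> (if i \<in> gens M then {l i..u i} else {0})) \<and>
     (\<Sum>n\<in>gens M. s n) = total_load M \<and> within_flow_limits M s}"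
proof -
  let ?B = "\<lambda>i. if i \<in> gens M then {l i..u i} else {0 :: real}"
  have cont: "continuous_on UNIV (\<lambda>s. matrix_flow M s e)" for e
    unfolding matrix_flow_def by (intro continuous_intros) auto
  have "compactin (product_topology (\<lambda>i. euclidean) UNIV) (PiE UNIV ?B)"
    by (subst compactin_PiE) auto
  then have "compact (PiE UNIV ?B)"
    by (simp add: euclidean_product_topology)
  moreover have "closed {s. (\<Sum>n\<in>gens M. s n) = total_load M}"
    by (intro closed_Collect_eq continuous_intros) auto
  moreover have "closed {s. within_flow_limits M s}"
    unfolding within_flow_limits_def Ball_def
    by (intro closed_Collect_all closed_Collect_imp closed_Collect_conj closed_Collect_le
        continuous_intros cont) auto
  ultimately have "compact (PiE UNIV ?B \<inter> {s. (\<Sum>n\<in>gens M. s n) = total_load M} \<inter>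
      {s. within_flow_limits M s})"
    by (intro compact_Int_closed)
  then show ?thesis
    by (rule back_subst[of compact]) (auto simp: PiE_UNIV_domain Pi_iff split: if_splits)
qed

end

section \<open>Minimizers of the bid cost and their first-order conditions\<close>

definition total_bid_cost :: "'v market \<Rightarrow> ('v \<Rightarrow> real) \<Rightarrow> real" where
  "total_bid_cost M s = (\<Sum>n\<in>gens M. bid_cost M n (s n))"

definition feasible_above :: "'v market \<Rightarrow> ('v \<Rightarrow> real) \<Rightarrow> ('v \<Rightarrow> real) \<Rightarrow> bool" where
  "feasible_above M l s \<longleftrightarrow>
     (\<Sum>n\<in>gens M. s n) = total_load M \<and>
     (\<forall>n\<in>gens M. l n \<le> s n \<and> s n \<le> supply_max M n) \<and>
     within_flow_limits M s"

context electricity_market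
begin

lemma bid_cost_minimizer_exists:
  assumes l: "\<And>n. n \<in> gens M \<Longrightarrow> 0 \<le> l n" and y: "feasible_above M l y"
  obtains s where "is_arg_min (total_bid_cost M) (feasible_above M l) s"
proof -
  define K where "K = {s. (\<forall>i. s i \<in> (if i \<in> gens M then {l i..supply_max M i} else {0})) \<and>
     (\<Sum>n\<in>gens M. s n) = total_load M \<and> within_flow_limits M s}"
  \<comment> \<open>Neither feasibility nor bid cost depends on entries outside
    \<open>gens M\<close>, so a minimum over the compact set \<open>K\<close> is global.\<close>
  define restrict where "restrict s = (\<lambda>i. if i \<in> gens M then s i else 0)" for s :: "'v \<Rightarrow> real"
  have K_feasible: "feasible_above M l s" if "s \<in> K" for s
    using that by (auto simp: K_def feasible_above_def split: if_splits)
  have restrict_K: "restrict s \<in> K" if "feasible_above M l s" for s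
    using that within_flow_limits_cong[of M "restrict s" s]
    by (auto simp: K_def restrict_def feasible_above_def)
  have restrict_cost: "total_bid_cost M (restrict s) = total_bid_cost M s" for s
    by (simp add: total_bid_cost_def restrict_def)
  have "K \<noteq> {}" using restrict_K[OF y] by auto
  moreover have "continuous_on K (total_bid_cost M)"
    unfolding total_bid_cost_def
  proof (intro continuous_intros)
    fix n assume n: "n \<in> gens M"
    have "0 \<le> s n" if "s \<in> K" for s
      using K_feasible[OF that] l[OF n] n by (force simp: feasible_above_def)
    then show "continuous_on K (\<lambda>s. bid_cost M n (s n))"
      by (intro continuous_on_compose2[OF bid_cost_continuous[OF n]]
          continuous_on_subset[OF continuous_on_product_coordinates]) auto
  qed
  moreover have "compact K" unfolding K_def by (rule compact_supplies)
  ultimately obtain s where s: "s \<in> K" "\<And>s'. s' \<in> K \<Longrightarrow> total_bid_cost M s \<le> total_bid_cost M s'"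
    using continuous_attains_inf[of K "total_bid_cost M"] by blast
  have "total_bid_cost M s \<le> total_bid_cost M s'" if "feasible_above M l s'" for s'
    using s(2)[OF restrict_K[OF that]] by (simp add: restrict_cost)
  then show thesis using K_feasible[OF s(1)] by (intro that[of s]) (auto simp: is_arg_min_def not_less)
qed

text \<open>First-order condition: along the transfer from \<open>m\<close> to \<open>n\<close> the
  total bid cost has initial slope
  \<open>bid_marginal M n (s n) - bid_marginal M m (s m)\<close>.\<close>

lemma bid_marginal_le_if_transfer_optimal:
  assumes l: "\<And>n. n \<in> gens M \<Longrightarrow> 0 \<le> l n"
    and min: "is_arg_min (total_bid_cost M) (feasible_above M l) s"
    and nm: "n \<in> gens M" "m \<in> gens M" "n \<noteq> m"
    and \<tau>: "0 < \<tau>" "within_flow_limits M (s(n := s n + \<tau>, m := s m - \<tau>))"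
    and room: "s n < supply_max M n" "l m < s m"
  shows "bid_marginal M m (s m) \<le> bid_marginal M n (s n)"
proof -
  have bounds: "l i \<le> s i \<and> s i \<le> supply_max M i" if "i \<in> gens M" for i
    using min that by (auto simp: is_arg_min_def feasible_above_def)
  have total: "(\<Sum>i\<in>gens M. s i) = total_load M" and flow: "within_flow_limits M s"
    using min by (auto simp: is_arg_min_def feasible_above_def)
  \<comment> \<open>Up to \<open>e\<close> the transfer respects the flow limits, the capacity of
    \<open>n\<close> and the lower limit of \<open>m\<close>.\<close>
  define e where "e = min \<tau> (min (supply_max M n - s n) (s m - l m))"
  have e: "0 < e" "e \<le> \<tau>" "e \<le> supply_max M n - s n" "e \<le> s m - l m"
    using \<tau> room by (auto simp: e_def)
  define move where "move = (\<lambda>h. s(n := s n + h, m := s m - h))"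
  define \<phi> where "\<phi> = (\<lambda>h. bid_cost M n (s n + h) + bid_cost M m (s m - h))"
  have s0: "0 \<le> s n" "0 \<le> s m" using l bounds nm order.trans by blast+
  have split: "(\<Sum>i\<in>gens M. f i) = f n + f m + (\<Sum>i\<in>gens M - {n} - {m}. f i)" for f :: "'v \<Rightarrow> real"
    using nm finite_gens by (simp add: sum.remove[of "gens M" n] sum.remove[of "gens M - {n}" m])
  have "(bid_cost M n has_real_derivative bid_marginal M n (s n)) (at (s n + 0) within (\<lambda>h. s n + h) ` {0..e})"
    using s0 by (auto intro!: DERIV_subset[OF bid_marginal[OF nm(1)]])
  moreover have "((\<lambda>h. s n + h) has_real_derivative 1) (at 0 within {0..e})"
    by (auto intro!: derivative_eq_intros)
  ultimately have 1: "((\<lambda>h. bid_cost M n (s n + h)) has_real_derivative bid_marginal M n (s n)) (at 0 within {0..e})"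
    using DERIV_image_chain[of "bid_cost M n" _ "\<lambda>h. s n + h" 0 "{0..e}" 1] by (simp add: o_def)
  have "(bid_cost M m has_real_derivative bid_marginal M m (s m)) (at (s m - 0) within (\<lambda>h. s m - h) ` {0..e})"
    using e(4) l[OF nm(2)] by (auto intro!: DERIV_subset[OF bid_marginal[OF nm(2)]] s0)
  moreover have "((\<lambda>h. s m - h) has_real_derivative - 1) (at 0 within {0..e})"
    by (auto intro!: derivative_eq_intros)
  ultimately have 2: "((\<lambda>h. bid_cost M m (s m - h)) has_real_derivative - bid_marginal M m (s m)) (at 0 within {0..e})"
    using DERIV_image_chain[of "bid_cost M m" _ "\<lambda>h. s m - h" 0 "{0..e}" "- 1"] by (simp add: o_def)
  have "(\<phi> has_real_derivative bid_marginal M n (s n) - bid_marginal M m (s m)) (at 0 within {0..e})"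
    unfolding \<phi>_def using DERIV_add[OF 1 2] by simp
  then have "0 \<le> bid_marginal M n (s n) - bid_marginal M m (s m)"
  proof (rule nonneg_derivative_if_right_min[OF _ e(1)])
    fix h assume h: "0 < h" "h < e"
    have "move h = (\<lambda>i. (1 - h / \<tau>) * s i + h / \<tau> * (s(n := s n + \<tau>, m := s m - \<tau>)) i)"
      using \<tau> nm by (auto simp: move_def field_simps)
    then have "within_flow_limits M (move h)"
      using within_flow_limits_convex[OF flow \<tau>(2), of "h / \<tau>"] h e \<tau> by simp
    moreover have "(\<Sum>i\<in>gens M. move h i) = total_load M"
      unfolding total[symmetric] split using nm by (simp add: move_def)
    moreover have "l i \<le> move h i \<and> move h i \<le> supply_max M i" if "i \<in> gens M" for i
      using bounds[OF that] h e nm by (auto simp: move_def)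
    ultimately have "feasible_above M l (move h)" by (simp add: feasible_above_def)
    then have "total_bid_cost M s \<le> total_bid_cost M (move h)"
      using min by (simp add: is_arg_min_def not_less)
    then have "\<phi> 0 \<le> \<phi> h"
      unfolding total_bid_cost_def split \<phi>_def using nm by (simp add: move_def)
    then show "0 + h \<in> {0..e} \<and> \<phi> 0 \<le> \<phi> (0 + h)" using h by simp
  qed
  then show ?thesis by simp
qed

text \<open>
  Flow constraints can make the average nodal price of the minimizer of \<open>total_bid_cost\<close> negative,
  and then no price turns it into an equilibrium: a supplier with zero marginal cost at zero output
  would always want to produce. Raising the lower bounds until all marginals are at least a
  positive \<open>p0\<close> guarantees a positive supporting price, and \<open>p0\<close> is at the same time the exact
  marginal at every bound that has been raised.
\<close>

lemma equilibrium_with_small_bid_cost: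
  assumes y: "feasible_supply M y" and above: "\<And>n. n \<in> gens M \<Longrightarrow> supply_min M n < y n"
  obtains w where "supply_function_equilibrium M w" "feasible_supply M (supply_profile M w)"
    "total_bid_cost M (supply_profile M w) \<le> total_bid_cost M y"
proof -
  have min0: "0 \<le> supply_min M n" if "n \<in> gens M" for n using supply_bounds[OF that] by simp
  \<comment> \<open>This is positive because \<open>y\<close> lies strictly above the lower limits,
    and every supplier reaches a marginal of \<open>p0\<close> without exceeding
    \<open>y\<close>.\<close>
  define p0 where "p0 = Min ((\<lambda>n. bid_marginal M n (y n)) ` gens M)"
  have p0_le: "p0 \<le> bid_marginal M n (y n)" if "n \<in> gens M" for n
    using that finite_gens by (simp add: p0_def)
  have "0 < bid_marginal M n (y n)" if "n \<in> gens M" for n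
    using above[OF that] min0[OF that] by (intro bid_marginal_pos that) simp
  then have p0: "0 < p0" using finite_gens gens_nonempty by (simp add: p0_def)
  have "\<exists>l. supply_min M n \<le> l \<and> l \<le> y n \<and> p0 \<le> bid_marginal M n l \<and>
      (l = supply_min M n \<or> bid_marginal M n l = p0)" if n: "n \<in> gens M" for n
  proof (cases "p0 \<le> bid_marginal M n (supply_min M n)")
    case True
    then show ?thesis using above[OF n] by (intro exI[of _ "supply_min M n"]) simp
  next
    case False
    obtain l where "l \<in> {supply_min M n..y n}" "bid_marginal M n l = p0"
    proof (rule derivative_intermediate_value[of "supply_min M n" "y n" "bid_cost M n" "bid_marginal M n" p0])
      show "(bid_cost M n has_real_derivative bid_marginal M n x) (at x within {supply_min M n..y n})"
        if "x \<in> {supply_min M n..y n}" for x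
        using that min0[OF n] by (intro DERIV_subset[OF bid_marginal[OF n]]) auto
    qed (use False above[OF n] p0_le[OF n] in auto)
    then show ?thesis by auto
  qed
  then have "\<forall>n\<in>gens M. \<exists>l. supply_min M n \<le> l \<and> l \<le> y n \<and> p0 \<le> bid_marginal M n l \<and>
      (l = supply_min M n \<or> bid_marginal M n l = p0)" by blast
  from bchoice[OF this]
  obtain l where l: "\<And>n. n \<in> gens M \<Longrightarrow> supply_min M n \<le> l n \<and> l n \<le> y n \<and>
      p0 \<le> bid_marginal M n (l n) \<and> (l n = supply_min M n \<or> bid_marginal M n (l n) = p0)"
    by blast
  have l0: "0 \<le> l n" if "n \<in> gens M" for n using l[OF that] min0[OF that] by simp
  have y_above: "feasible_above M l y" using y l by (simp add: feasible_above_def feasible_supply_def)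
  obtain s where min: "is_arg_min (total_bid_cost M) (feasible_above M l) s"
    using bid_cost_minimizer_exists[OF l0 y_above] by blast
  have y_min: "total_bid_cost M s \<le> total_bid_cost M y"
    using min y_above by (simp add: is_arg_min_def not_less)
  have bounds: "l n \<le> s n \<and> s n \<le> supply_max M n" if "n \<in> gens M" for n
    using min that by (auto simp: is_arg_min_def feasible_above_def)
  have total: "(\<Sum>n\<in>gens M. s n) = total_load M" and flow: "within_flow_limits M s"
    using min by (auto simp: is_arg_min_def feasible_above_def)
  \<comment> \<open>The suppliers that can still produce less. The price \<open>p\<close> is at
    least their marginals, and \<open>p0\<close> keeps it positive.\<close>
  define L where "L = {m \<in> gens M. l m < s m \<and>
    (\<exists>\<sigma>>0. within_flow_limits M (deviation M s m (- \<sigma>)))}"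
  define p where "p = Max (insert p0 ((\<lambda>m. bid_marginal M m (s m)) ` L))"
  have finL: "finite L" unfolding L_def using finite_gens by simp
  have p_ge: "p0 \<le> p" "\<And>m. m \<in> L \<Longrightarrow> bid_marginal M m (s m) \<le> p"
    using finL by (auto simp: p_def)
  have p: "0 < p" using p_ge(1) p0 by simp
  have s_bounds: "supply_min M n \<le> s n \<and> s n \<le> supply_max M n" if "n \<in> gens M" for n
    using bounds[OF that] l[OF that] by simp
  define w where "w = (\<lambda>m. p * (total_load M - s m))"
  have up: "p \<le> bid_marginal M n (s n)"
    if n: "n \<in> gens M" "0 < \<rho>" "within_flow_limits M (deviation M s n \<rho>)" "s n < supply_max M n" for n \<rho>
  proof -
    have "p0 \<le> bid_marginal M n (s n)"
      using l[OF n(1)] bid_marginal_mono[OF n(1) l0[OF n(1)], of "s n"] bounds[OF n(1)] by simp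
    \<comment> \<open>As \<open>n\<close> can go up and \<open>m\<close> down, a transfer between
      them is possible, and minimality orders their marginals.\<close>
    moreover have "bid_marginal M m (s m) \<le> bid_marginal M n (s n)" if mL: "m \<in> L" for m
    proof (cases "n = m")
      case False
      obtain \<sigma> where m: "m \<in> gens M" "l m < s m" "0 < \<sigma>"
        "within_flow_limits M (deviation M s m (- \<sigma>))"
        using mL by (auto simp: L_def)
      obtain \<tau> where \<tau>: "0 < \<tau>" "within_flow_limits M (s(n := s n + \<tau>, m := s m - \<tau>))"
        using within_flow_limits_transfer[OF flow False n(2,3) m(3,4)] .
      show ?thesis
        by (rule bid_marginal_le_if_transfer_optimal[OF l0 min n(1) m(1) False \<tau> n(4) m(2)])
    qed simp
    ultimately show ?thesis using finL by (simp add: p_def)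
  qed
  have down: "bid_marginal M n (s n) \<le> p"
    if n: "n \<in> gens M" "0 < \<rho>" "within_flow_limits M (deviation M s n (- \<rho>))" "supply_min M n < s n" for n \<rho>
  proof (cases "l n < s n")
    case True
    then show ?thesis using n by (intro p_ge) (auto simp: L_def)
  next
    case False
    then have "s n = l n" using bounds[OF n(1)] by simp
    \<comment> \<open>Since \<open>s n\<close> exceeds \<open>supply_min M n\<close>, the limit
      \<open>l n\<close> has been raised, so the marginal there is exactly
      \<open>p0\<close>.\<close>
    then show ?thesis using l[OF n(1)] n(4) p_ge(1) by auto
  qed
  have eq: "supply_function_equilibrium M w"
    by (rule equilibrium_if_price_supports(1)[OF p total s_bounds flow up down w_def])
  have profile: "supply_profile M w n = s n" if "n \<in> gens M" for n
    by (rule equilibrium_if_price_supports(2)[OF p total s_bounds flow up down w_def that])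
  have "feasible_supply M (supply_profile M w)"
    using profile total s_bounds flow within_flow_limits_cong[of M "supply_profile M w" s]
    by (simp add: feasible_supply_def)
  then show thesis
    using that[OF eq] profile y_min by (simp add: total_bid_cost_def)
qed

end

section \<open>Cycles and effective flow limits\<close>

text \<open>Once the closing line is split off, the other differences telescope to its
  negative.\<close>

lemma cycle_telescope:
  fixes \<theta> :: "'v \<Rightarrow> real"
  assumes "ns \<noteq> []"
  shows "(\<Sum>k<length ns. \<theta> (ns ! (Suc k mod length ns)) - \<theta> (ns ! k)) = 0"
proof -
  obtain l where l: "length ns = Suc l" using assms by (cases "length ns") auto
  have "(\<Sum>k<l. \<theta> (ns ! (Suc k mod Suc l)) - \<theta> (ns ! k)) = (\<Sum>k<l. \<theta> (ns ! Suc k) - \<theta> (ns ! k))"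
    by (intro sum.cong) auto
  also have "\<dots> = \<theta> (ns ! l) - \<theta> (ns ! 0)" by (rule sum_lessThan_telescope)
  finally show ?thesis by (simp add: l)
qed

text \<open>Lines are unordered, but two positions with opposite orientations of one line would
  force at most two nodes. Injectivity turns sums over positions into sums over lines.\<close>

lemma cycle_line_inj:
  assumes "distinct ns" "3 \<le> length ns"
  shows "inj_on (cycle_line ns) {..<length ns}"
proof (rule inj_onI)
  fix j k assume jk: "j \<in> {..<length ns}" "k \<in> {..<length ns}" "cycle_line ns j = cycle_line ns k"
  have nth: "ns ! a = ns ! b \<longleftrightarrow> a = b" if "a < length ns" "b < length ns" for a b
    using that assms(1) by (simp add: nth_eq_iff_index_eq)
  have less: "Suc a mod length ns < length ns" for a by (rule mod_less_divisor) (use assms(2) in linarith)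
  have "j = k \<or> (j = Suc k mod length ns \<and> Suc j mod length ns = k)"
    using jk(3) nth[of j k] nth[OF _ less, of j k] nth[OF less, of k j] jk(1,2)
    unfolding cycle_line_def doubleton_eq_iff by blast
  then show "j = k"
    using jk(1,2) assms(2) by (auto simp: mod_Suc split: if_splits)
qed

text \<open>The difference across one line is minus the sum over the others. The bound holds for
  both orders of the ends, hence for absolute values.\<close>

lemma angle_difference_le_cycle:
  fixes \<theta> :: "'v \<Rightarrow> real"
  assumes ns: "distinct ns" "3 \<le> length ns" and k: "k < length ns"
    and le: "\<And>i j. {i, j} \<in> cycle_lines ns \<Longrightarrow> \<theta> i - \<theta> j \<le> r {i, j}"
    and nm: "{n, m} = cycle_line ns k"
  shows "\<theta> n - \<theta> m \<le> (\<Sum>e\<in>cycle_lines ns - {{n, m}}. r e)"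
proof -
  let ?d = "\<lambda>k. \<theta> (ns ! (Suc k mod length ns)) - \<theta> (ns ! k)"
  have d: "\<bar>?d j\<bar> \<le> r (cycle_line ns j)" if "j < length ns" for j
    using le[of "ns ! j" "ns ! (Suc j mod length ns)"] le[of "ns ! (Suc j mod length ns)" "ns ! j"] that
    by (auto simp: cycle_line_def cycle_lines_def insert_commute)
  have "ns \<noteq> []" using ns by auto
  then have "?d k + (\<Sum>j\<in>{..<length ns} - {k}. ?d j) = 0"
    using cycle_telescope[of ns \<theta>] k by (simp add: sum.remove)
  then have "\<bar>?d k\<bar> = \<bar>\<Sum>j\<in>{..<length ns} - {k}. ?d j\<bar>" by linarith
  also have "\<dots> \<le> (\<Sum>j\<in>{..<length ns} - {k}. r (cycle_line ns j))"
    using d by (intro order.trans[OF sum_abs] sum_mono) auto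
  also have "\<dots> = (\<Sum>e\<in>cycle_line ns ` ({..<length ns} - {k}). r e)"
    using cycle_line_inj[OF ns] by (simp add: sum.reindex inj_on_diff)
  also have "cycle_line ns ` ({..<length ns} - {k}) = cycle_lines ns - {{n, m}}"
    using cycle_line_inj[OF ns] k by (auto simp: cycle_lines_def nm inj_on_def)
  finally show ?thesis
    using nm by (auto simp: cycle_line_def doubleton_eq_iff insert_commute)
qed

lemma cycle_through_line:
  assumes "cycle_through M i n j ns"
  obtains k k' where "k < length ns" "{n, i} = cycle_line ns k" "k' < length ns" "{n, j} = cycle_line ns k'"
proof -
  have len: "length ns > 0" using assms by (auto simp: cycle_through_def is_cycle_def)
  have "\<exists>k<length ns. \<exists>k'<length ns. {n, a} = cycle_line ns k \<and> {n, b} = cycle_line ns k'"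
    if ab: "consecutive ns a n b" for a b
  proof -
    obtain k where "k < length ns" "ns ! k = a" "ns ! (Suc k mod length ns) = n"
      "ns ! (Suc (Suc k) mod length ns) = b"
      using ab by (auto simp: consecutive_def)
    then have "{n, a} = cycle_line ns k" "{n, b} = cycle_line ns (Suc k mod length ns)"
      by (simp_all add: cycle_line_def mod_Suc_eq insert_commute)
    then show ?thesis using \<open>k < length ns\<close> mod_less_divisor[OF len] by blast
  qed
  then show thesis using assms that unfolding cycle_through_def by metis
qed

context electricity_network
begin

lemma line_flow_le_effective_limit:
  assumes part: "neighbor_partition M n P" and cyc: "cycle_mapping M n P C"
    and p: "line_flows M s p" "\<And>e. e \<in> lines M \<Longrightarrow> \<bar>p (tail M e) (head M e)\<bar> \<le> flow_limit M e"
    and m: "m \<in> neighbors M n"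
  shows "p n m \<le> effective_flow_limit M P C n m"
proof -
  obtain \<theta> where \<theta>: "\<And>i j. {i, j} \<in> lines M \<Longrightarrow> p i j = admittance M {i, j} * (\<theta> i - \<theta> j)"
    using p(1) by (auto simp: line_flows_def)
  \<comment> \<open>The limits are given along the chosen orientation; antisymmetry of the flow
    gives them in both directions.\<close>
  have lim: "\<bar>p i j\<bar> \<le> flow_limit M {i, j}" if ij: "{i, j} \<in> lines M" for i j
  proof -
    have "p j i = - p i j"
      using \<theta>[OF ij] \<theta>[of j i] ij by (simp add: insert_commute algebra_simps)
    moreover have "(tail M {i, j} = i \<and> head M {i, j} = j) \<or> (tail M {i, j} = j \<and> head M {i, j} = i)"
      using orientation[OF ij] by (auto simp: doubleton_eq_iff)
    ultimately show ?thesis using p(2)[OF ij] by auto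
  qed
  have nm: "{n, m} \<in> lines M" using m by (simp add: neighbors_def)
  have nm_lim: "p n m \<le> flow_limit M {n, m}" using lim[OF nm] by simp
  show ?thesis
  proof (cases "{m} \<in> P")
    case True
    then show ?thesis using nm_lim by (simp add: effective_flow_limit_def)
  next
    case False
    have P: "partition_on (neighbors M n) P" "\<And>X. X \<in> P \<Longrightarrow> card X = 1 \<or> card X = 2"
      using part by (auto simp: neighbor_partition_def)
    obtain X where X: "X \<in> P" "m \<in> X" using P(1) m by (auto simp: partition_on_def)
    \<comment> \<open>Disjointness of the parts identifies the one selected in
      \<open>effective_flow_limit\<close>.\<close>
    have the_X: "(THE X. X \<in> P \<and> m \<in> X) = X"
      using X P(1) by (intro the_equality) (auto simp: partition_on_def disjoint_def)
    have "card X \<noteq> 1" using X False by (auto simp: card_1_singleton_iff)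
    then obtain i where i: "X = {m, i}" "m \<noteq> i"
      using P(2)[OF X(1)] X(2) by (auto simp: card_2_iff doubleton_eq_iff)
    have ct: "cycle_through M m n i (C X)" using cyc X i by (auto simp: cycle_mapping_def)
    have cycle: "is_cycle M (C X)" using ct by (simp add: cycle_through_def)
    obtain k where k: "k < length (C X)" "{n, m} = cycle_line (C X) k"
      using cycle_through_line[OF ct] by metis
    have le: "\<theta> i - \<theta> j \<le> flow_limit M {i, j} / admittance M {i, j}"
      if "{i, j} \<in> cycle_lines (C X)" for i j
    proof -
      have ij: "{i, j} \<in> lines M" using that cycle by (auto simp: is_cycle_def)
      show ?thesis
        using lim[OF ij] \<theta>[OF ij] admittance_pos[OF ij] by (simp add: field_simps)
    qed
    have "\<theta> n - \<theta> m \<le> (\<Sum>e\<in>cycle_lines (C X) - {{n, m}}. flow_limit M e / admittance M e)"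
      using cycle k le by (intro angle_difference_le_cycle) (auto simp: is_cycle_def)
    then have "p n m \<le> (\<Sum>e\<in>cycle_lines (C X) - {{n, m}}. flow_limit M e / admittance M e) * admittance M {n, m}"
      using \<theta>[OF nm] admittance_pos[OF nm] by (simp add: mult.commute)
    then show ?thesis using False nm_lim the_X by (simp add: effective_flow_limit_def)
  qed
qed

text \<open>By flow balance at \<open>n\<close>, the supply minus the local load is the sum of the
  outgoing flows.\<close>

lemma supply_le_effective_limits:
  assumes n: "n \<in> gens M" and part: "neighbor_partition M n P" and cyc: "cycle_mapping M n P C"
    and total: "(\<Sum>n\<in>gens M. s n) = total_load M" and flow: "within_flow_limits M s"
  shows "s n \<le> load M n + (\<Sum>m\<in>neighbors M n. effective_flow_limit M P C n m)"
proof -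
  obtain p where p: "line_flows M s p" "\<And>e. e \<in> lines M \<Longrightarrow> p (tail M e) (head M e) = matrix_flow M s e"
    using shift_factors[OF total] by blast
  have "\<bar>p (tail M e) (head M e)\<bar> \<le> flow_limit M e" if "e \<in> lines M" for e
    using flow that p(2)[OF that] by (auto simp: within_flow_limits_def abs_le_iff)
  then have "(\<Sum>m\<in>neighbors M n. p n m) \<le> (\<Sum>m\<in>neighbors M n. effective_flow_limit M P C n m)"
    by (intro sum_mono line_flow_le_effective_limit[OF part cyc p(1)]) auto
  moreover have "(\<Sum>m\<in>neighbors M n. p n m) = s n - load M n"
    using p(1) n gens_subset by (auto simp: line_flows_def)
  ultimately show ?thesis by simp
qed

end

section \<open>The price of anarchy\<close>

context electricity_market
begin

text \<open>\<open>s_opt\<close> may touch the lower limits, which the equilibrium construction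
  excludes. It is mixed with a strictly feasible profile whose weight \<open>t\<close> tends to
  0.\<close>

lemma equilibrium_cost_le_bid_cost_optimum:
  assumes eq: "equilibrium_supply M s_eq" and opt: "feasible_supply M s_opt"
  shows "total_cost M s_eq \<le> total_bid_cost M s_opt"
proof -
  obtain s0 where s0: "(\<Sum>n\<in>gens M. s0 n) = total_load M"
      "\<And>n. n \<in> gens M \<Longrightarrow> supply_min M n < s0 n \<and> s0 n < supply_max M n"
      "within_flow_limits M s0"
    using strictly_feasible unfolding within_flow_limits_def by (meson less_imp_le)
  define y where "y = (\<lambda>t n. (1 - t) * s_opt n + t * s0 n)"
  have opt_bounds: "supply_min M n \<le> s_opt n \<and> s_opt n \<le> supply_max M n" if "n \<in> gens M" for n
    using opt that by (simp add: feasible_supply_def)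
  have y_above: "supply_min M n < y t n" if "n \<in> gens M" "0 < t" "t < 1" for n t
  proof -
    have "(1 - t) * supply_min M n + t * supply_min M n < (1 - t) * s_opt n + t * s0 n"
      using that opt_bounds[of n] s0(2)[of n] by (intro add_le_less_mono mult_left_mono mult_strict_left_mono) auto
    then show ?thesis by (simp add: y_def algebra_simps)
  qed
  have y_below: "y t n \<le> supply_max M n" if "n \<in> gens M" "0 < t" "t < 1" for n t
    unfolding y_def using that opt_bounds[of n] s0(2)[of n]
    by (intro convex_bound_le) (auto intro: less_imp_le)
  have le: "total_cost M s_eq \<le> total_bid_cost M (y t)" if t: "0 < t" "t < 1" for t
  proof -
    have "(\<Sum>n\<in>gens M. y t n) = (1 - t) * (\<Sum>n\<in>gens M. s_opt n) + t * (\<Sum>n\<in>gens M. s0 n)"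
      by (simp add: y_def sum.distrib sum_distrib_left)
    then have "(\<Sum>n\<in>gens M. y t n) = total_load M"
      using opt s0(1) by (simp add: feasible_supply_def algebra_simps)
    moreover have "within_flow_limits M (y t)"
      unfolding y_def using opt s0(3) t by (intro within_flow_limits_convex) (auto simp: feasible_supply_def)
    ultimately have "feasible_supply M (y t)"
      using y_above[OF _ t] y_below[OF _ t] by (simp add: feasible_supply_def less_imp_le)
    then obtain w where w: "supply_function_equilibrium M w" "feasible_supply M (supply_profile M w)"
        "total_bid_cost M (supply_profile M w) \<le> total_bid_cost M (y t)"
      using equilibrium_with_small_bid_cost[OF _ y_above[OF _ t]] by blast
    \<comment> \<open>The equilibrium \<open>w\<close> depends on \<open>t\<close>, but all
      equilibria share the supplies \<open>s_eq\<close>.\<close>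
    have s_eq: "s_eq n = supply_profile M w n" if "n \<in> gens M" for n
      using eq w(1) that by (simp add: equilibrium_supply_def)
    have "0 \<le> supply_profile M w n" if "n \<in> gens M" for n
      using w(2) supply_bounds[OF that] that by (force simp: feasible_supply_def)
    then have "total_cost M s_eq \<le> total_bid_cost M (supply_profile M w)"
      unfolding total_cost_def total_bid_cost_def by (intro sum_mono) (simp add: s_eq cost_le_bid_cost)
    then show ?thesis using w(3) by simp
  qed
  have "continuous_on {0..1} (\<lambda>t. total_bid_cost M (y t))"
    unfolding total_bid_cost_def
  proof (intro continuous_intros)
    fix n assume n: "n \<in> gens M"
    have "0 \<le> s_opt n" "0 \<le> s0 n"
      using opt_bounds[OF n] s0(2)[OF n] supply_bounds[OF n] by auto
    then show "continuous_on {0..1} (\<lambda>t. bid_cost M n (y t n))"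
      unfolding y_def
      by (intro continuous_on_compose2[OF bid_cost_continuous[OF n]] continuous_intros) auto
  qed
  then have "((\<lambda>t. total_bid_cost M (y t)) \<longlongrightarrow> total_bid_cost M (y 0)) (at_right 0)"
    by (auto simp: continuous_on_def at_within_Icc_at_right dest!: bspec[of _ _ 0])
  moreover have "\<forall>\<^sub>F t in at_right 0. total_cost M s_eq \<le> total_bid_cost M (y t)"
    using eventually_at_right_real[of 0 1] le by (auto elim!: eventually_mono)
  ultimately have "total_cost M s_eq \<le> total_bid_cost M (y 0)"
    by (rule tendsto_lowerbound) simp
  then show ?thesis by (simp add: y_def)
qed

text \<open>Positive load forces some positive supply, whose cost exceeds the nonnegative cost of
  0.\<close>

lemma total_cost_pos:
  assumes "feasible_supply M s"
  shows "0 < total_cost M s"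
proof -
  have s0: "0 \<le> s n" if "n \<in> gens M" for n
    using assms supply_bounds[OF that] that by (force simp: feasible_supply_def)
  have "\<exists>n\<in>gens M. 0 < s n"
  proof (rule ccontr)
    assume "\<not> ?thesis"
    then have "(\<Sum>n\<in>gens M. s n) \<le> 0" by (intro sum_nonpos) (simp add: not_less)
    then show False using assms total_load_pos by (simp add: feasible_supply_def)
  qed
  then obtain n where n: "n \<in> gens M" "0 < s n" by blast
  have "0 < cost M n (s n)" using cost_less[OF n(1) _ n(2)] cost_ge_0[OF n(1), of 0] by simp
  then show ?thesis
    unfolding total_cost_def using n(1) finite_gens s0 by (intro sum_pos2[of _ n] cost_ge_0) auto
qed

lemma supply_le_residual_minimum:
  assumes "feasible_supply M s" "n \<in> gens M"
  shows "s n \<le> total_load M - (\<Sum>m\<in>gens M - {n}. supply_min M m)"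
proof -
  have "(\<Sum>m\<in>gens M - {n}. supply_min M m) \<le> (\<Sum>m\<in>gens M - {n}. s m)"
    using assms by (intro sum_mono) (auto simp: feasible_supply_def)
  also have "\<dots> = total_load M - s n"
    using assms finite_gens by (simp add: sum_diff1 feasible_supply_def)
  finally show ?thesis by simp
qed

end

theorem theorem1:
  fixes M :: "'v market"
    and P :: "'v \<Rightarrow> 'v set set"
    and C :: "'v \<Rightarrow> 'v set \<Rightarrow> 'v list"
    and s_eq s_opt :: "'v \<Rightarrow> real"
  assumes "electricity_market M"
    and "\<And>n. n \<in> gens M \<Longrightarrow> neighbor_partition M n (P n)"
    and "\<And>n. n \<in> gens M \<Longrightarrow> cycle_mapping M n (P n) (C n)"
    and "equilibrium_supply M s_eq"
    and "social_optimum M s_opt"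
  shows "price_of_anarchy M s_eq s_opt \<le>
    1 + (MAX n\<in>gens M.
           Min {supply_max M n,
                total_load M - (\<Sum>m\<in>gens M - {n}. supply_min M m),
                load M n + (\<Sum>m\<in>neighbors M n. effective_flow_limit M (P n) (C n) n m)}
             / ((real (card (gens M)) - 2) * total_load M))"
proof -
  interpret electricity_market M by fact
  define B where "B = (\<lambda>n. Min {supply_max M n,
    total_load M - (\<Sum>m\<in>gens M - {n}. supply_min M m),
    load M n + (\<Sum>m\<in>neighbors M n. effective_flow_limit M (P n) (C n) n m)} / markup_base M)"
  define R where "R = (MAX n\<in>gens M. B n)"
  have opt: "feasible_supply M s_opt"
    using assms(5) by (simp add: social_optimum_def is_arg_min_def)
  \<comment> \<open>All three terms of the minimum bound the optimal supply, so each markup factor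
    at the optimum is at most \<open>1 + R\<close>.\<close>
  have share: "s_opt n / markup_base M \<le> R" if n: "n \<in> gens M" for n
  proof -
    have "s_opt n \<le> load M n + (\<Sum>m\<in>neighbors M n. effective_flow_limit M (P n) (C n) n m)"
      using opt assms(2,3)[OF n]
      by (intro supply_le_effective_limits[OF n]) (auto simp: feasible_supply_def)
    moreover have "s_opt n \<le> supply_max M n" using opt n by (simp add: feasible_supply_def)
    ultimately have "s_opt n / markup_base M \<le> B n"
      unfolding B_def using supply_le_residual_minimum[OF opt n] markup_base_pos
      by (intro divide_right_mono) auto
    also have "B n \<le> R" unfolding R_def using n finite_gens by (intro Max_ge) auto
    finally show ?thesis .
  qed
  have s0: "0 \<le> s_opt n" if "n \<in> gens M" for n
    using opt supply_bounds[OF that] that by (force simp: feasible_supply_def)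
  have "total_cost M s_eq \<le> total_bid_cost M s_opt"
    using assms(4) opt by (rule equilibrium_cost_le_bid_cost_optimum)
  also have "\<dots> \<le> (\<Sum>n\<in>gens M. cost M n (s_opt n) * (1 + R))"
    unfolding total_bid_cost_def
  proof (rule sum_mono)
    fix n assume n: "n \<in> gens M"
    have "bid_cost M n (s_opt n) \<le> cost M n (s_opt n) * (1 + s_opt n / markup_base M)"
      using n s0[OF n] by (rule bid_cost_le)
    also have "\<dots> \<le> cost M n (s_opt n) * (1 + R)"
      using share[OF n] cost_ge_0[OF n s0[OF n]] by (intro mult_left_mono) auto
    finally show "bid_cost M n (s_opt n) \<le> cost M n (s_opt n) * (1 + R)" .
  qed
  also have "\<dots> = (1 + R) * total_cost M s_opt"
    by (simp add: total_cost_def mult.commute flip: sum_distrib_left)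
  finally have "price_of_anarchy M s_eq s_opt \<le> 1 + R"
    using total_cost_pos[OF opt] by (simp add: price_of_anarchy_def divide_le_eq)
  then show ?thesis by (simp add: R_def B_def markup_base_def)
qed

end
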